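(* Let $r\ge 3$ be odd, let $n\ge r$, and let $g=\Psi_{2,n}^{(r-1,r)}f$ for some $f\in\mathcal{H}_n^{(r-1)}(\mathbb{F}_2)$, where $(\Psi_{2,n}^{(r-1,r)}f)(e)=\sum_{e'\subseteq e,\ |e'|=r-1} f(e')$ for every $r$-element subset $e$ of the vertex set $V$. Let $X\subseteq V$ and $c\in\mathbb{F}_2$, and suppose $g(e)=c$ for every $r$-element subset $e\subseteq X$ (i.e. the image of the subhypergraph $K$ of $K_n^{(r-1)}$ induced by $X$ is complete in color $c$). Then the $(r-1)$-uniform hypergraph with vertex set $X$ whose hyperedges are the $(r-1)$-element subsets $e'\subseteq X$ with $f(e')=c$ has at most $r-1$ connected components.
   Context: $\mathbb{F}_2$ is the field with two elements. For $2\le k\le n$, $K_n^{(k)}$ is the complete $k$-uniform hypergraph on a fixed $n$-element vertex set $V$ (hyperedges: all $k$-element subsets of $V$), and $\mathcal{H}_n^{(k)}(\mathbb{F}_2)$ is the set of all maps $E(K_n^{(k)})\to\mathbb{F}_2$. Connected components of a hypergraph: two vertices lie in the same component if they are joined by a finite sequence of hyperedges, consecutive ones intersecting; a vertex lying in no hyperedge forms its own component. *)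

theory Defs
  imports "HOL-Library.Z2" "HOL-Library.FuncSet" "HOL-Library.Ramsey"
begin

text \<open>The hyperedges of the complete \<open>k\<close>-uniform hypergraph on \<open>V\<close> are \<^term>\<open>nsets V k\<close>;
  the field with two elements is the type \<^typ>\<open>bit\<close>.\<close>

definition hyper_maps :: "'a set \<Rightarrow> nat \<Rightarrow> ('a set \<Rightarrow> bit) set" where
  "hyper_maps V k = nsets V k \<rightarrow>\<^sub>E UNIV"

definition Psi :: "'a set \<Rightarrow> nat \<Rightarrow> nat \<Rightarrow> ('a set \<Rightarrow> bit) \<Rightarrow> 'a set \<Rightarrow> bit" where
  "Psi V k r f = (\<lambda>e\<in>nsets V r. \<Sum>e'\<in>nsets e k. f e')"

definition hyperedge_joined :: "'a set set \<Rightarrow> 'a \<Rightarrow> 'a \<Rightarrow> bool" where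
  "hyperedge_joined E u v \<longleftrightarrow>
     (\<exists>es. es \<noteq> [] \<and> set es \<subseteq> E \<and> u \<in> hd es \<and> v \<in> last es \<and>
           successively (\<lambda>e e'. e \<inter> e' \<noteq> {}) es)"

text \<open>The disjunct \<open>u = v\<close> makes a vertex lying in no hyperedge a component of its own.\<close>

definition same_component :: "'a set \<Rightarrow> 'a set set \<Rightarrow> ('a \<times> 'a) set" where
  "same_component X E = {(u, v). u \<in> X \<and> v \<in> X \<and> (u = v \<or> hyperedge_joined E u v)}"

definition hyper_components :: "'a set \<Rightarrow> 'a set set \<Rightarrow> 'a set set" where
  "hyper_components X E = X // same_component X E"

lemma hyperedge_joined_sym:
  assumes "hyperedge_joined E u v"
  shows "hyperedge_joined E v u"
proof -
  obtain es where es: "es \<noteq> []" "set es \<subseteq> E" "u \<in> hd es" "v \<in> last es"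
    "successively (\<lambda>e e'. e \<inter> e' \<noteq> {}) es"
    using assms unfolding hyperedge_joined_def by blast
  have "successively (\<lambda>e e'. e \<inter> e' \<noteq> {}) (rev es)"
    using es(5) by (simp add: Int_commute)
  then show ?thesis
    unfolding hyperedge_joined_def using es by (intro exI[of _ "rev es"]) (simp add: hd_rev last_rev)
qed

lemma hyperedge_joined_trans:
  assumes "hyperedge_joined E u v" and "hyperedge_joined E v w"
  shows "hyperedge_joined E u w"
proof -
  obtain es where es: "es \<noteq> []" "set es \<subseteq> E" "u \<in> hd es" "v \<in> last es"
    "successively (\<lambda>e e'. e \<inter> e' \<noteq> {}) es"
    using assms(1) unfolding hyperedge_joined_def by blast
  obtain fs where fs: "fs \<noteq> []" "set fs \<subseteq> E" "v \<in> hd fs" "w \<in> last fs"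
    "successively (\<lambda>e e'. e \<inter> e' \<noteq> {}) fs"
    using assms(2) unfolding hyperedge_joined_def by blast
  have "last es \<inter> hd fs \<noteq> {}"
    using es(4) fs(3) by blast
  then show ?thesis
    unfolding hyperedge_joined_def using es fs
    by (intro exI[of _ "es @ fs"]) (simp add: successively_append_iff)
qed

lemma equiv_same_component: "equiv X (same_component X E)"
  by (intro equivI refl_onI symI transI)
     (auto simp: same_component_def intro: hyperedge_joined_sym hyperedge_joined_trans)

end

theory Submission
  imports Defs
begin

text \<open>Given \<open>r\<close> components, pick one vertex from each. An \<open>(r - 1)\<close>-subset of these \<open>r\<close> vertices
  meets two components, so it is not a hyperedge and \<open>f\<close> takes the value \<open>c + 1\<close> on it. As \<open>r\<close> is
  odd, the sum of \<open>f\<close> over the \<open>r\<close> such subsets is \<open>c + 1 \<noteq> c\<close>.\<close>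

lemma hyperedge_joined_in_edge:
  assumes "e \<in> E" and "u \<in> e" and "v \<in> e"
  shows "hyperedge_joined E u v"
  unfolding hyperedge_joined_def using assms by (intro exI[of _ "[e]"]) simp

text \<open>The vertices of \<open>R\<close> represent \<open>k\<close> distinct classes of an
  equivalence relation; two joined representatives would put their classes in relation, so the
  classes, and with them the vertices, coincide.\<close>

lemma component_transversal:
  assumes "k \<le> card (hyper_components X E)"
  obtains R where "R \<in> nsets X k" and "\<And>u v. u \<in> R \<Longrightarrow> v \<in> R \<Longrightarrow> hyperedge_joined E u v \<Longrightarrow> u = v"
proof -
  obtain T where T: "T \<subseteq> hyper_components X E" "card T = k" "finite T"
    using obtain_subset_with_card_n[OF assms] by blast
  define rep where "rep = (\<lambda>C. SOME x :: 'a. x \<in> C)"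
  have rep_in: "rep C \<in> C" if "C \<in> T" for C
    using in_quotient_imp_non_empty[OF equiv_same_component, of C X E] that T(1)
    by (auto simp: rep_def hyper_components_def some_in_eq)
  have rep_X: "rep C \<in> X" if "C \<in> T" for C
    using in_quotient_imp_subset[OF equiv_same_component, of C X E] rep_in that T(1)
    by (auto simp: hyper_components_def)
  have rep_sep: "C = D" if "C \<in> T" "D \<in> T" "(rep C, rep D) \<in> same_component X E" for C D
    using quotient_eqI[OF equiv_same_component, of C X E D] rep_in that T(1)
    by (auto simp: hyper_components_def)
  \<comment> \<open>Equal representatives are related by reflexivity on \<open>X\<close>, so
    \<open>rep_sep\<close> identifies their classes.\<close>
  have "inj_on rep T"
    by (rule inj_onI) (metis rep_sep rep_X equiv_same_component equivE refl_onD)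
  then have "rep ` T \<in> nsets X k"
    using T rep_X by (auto simp: nsets_def card_image)
  moreover have "u = v" if "u \<in> rep ` T" "v \<in> rep ` T" "hyperedge_joined E u v" for u v
    using that rep_sep rep_X by (auto simp: same_component_def)
  ultimately show thesis by (rule that)
qed

theorem theorem6:
  fixes V X :: "'a set" and n r :: nat and f g :: "'a set \<Rightarrow> bit" and c :: bit
  assumes "finite V" and "card V = n"
    and "r \<ge> 3" and "odd r" and "n \<ge> r"
    and "f \<in> hyper_maps V (r - 1)"
    and "g = Psi V (r - 1) r f"
    and "X \<subseteq> V"
    and "\<And>e. e \<in> nsets X r \<Longrightarrow> g e = c"
  shows "card (hyper_components X {e' \<in> nsets X (r - 1). f e' = c}) \<le> r - 1"
proof (rule ccontr)
  let ?E = "{e' \<in> nsets X (r - 1). f e' = c}"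
  assume "\<not> card (hyper_components X ?E) \<le> r - 1"
  then have "r \<le> card (hyper_components X ?E)" by simp
  then obtain R where R: "R \<in> nsets X r"
    and sep: "\<And>u v. u \<in> R \<Longrightarrow> v \<in> R \<Longrightarrow> hyperedge_joined ?E u v \<Longrightarrow> u = v"
    by (rule component_transversal) blast
  have f_R: "f e' = c + 1" if e': "e' \<in> nsets R (r - 1)" for e'
  proof -
    \<comment> \<open>Here \<open>r \<ge> 3\<close> enters: \<open>r - 1 \<ge> 2\<close>, so
      \<open>e'\<close> contains two distinct vertices of \<open>R\<close>.\<close>
    have "\<not> card e' \<le> Suc 0" "finite e'" "e' \<subseteq> R"
      using e' \<open>r \<ge> 3\<close> by (auto simp: nsets_def)
    then obtain u v where uv: "u \<in> e'" "v \<in> e'" "u \<noteq> v"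
      using card_le_Suc0_iff_eq by blast
    have "e' \<in> nsets X (r - 1)"
      using e' R by (auto simp: nsets_def)
    \<comment> \<open>Otherwise \<open>e'\<close> would be a hyperedge and, as a chain of length
      one, would join \<open>u\<close> to \<open>v\<close> against \<open>sep\<close>.\<close>
    then have "f e' \<noteq> c"
      using hyperedge_joined_in_edge[of e' ?E u v] sep uv \<open>e' \<subseteq> R\<close> by blast
    then show ?thesis
      by (cases "f e'"; cases c) auto
  qed
  \<comment> \<open>\<open>Psi\<close> is the sum only on \<open>nsets V r\<close> and
    \<open>undefined\<close> elsewhere, hence this membership.\<close>
  have "R \<in> nsets V r"
    using R \<open>X \<subseteq> V\<close> by (auto simp: nsets_def)
  then have "g R = (\<Sum>e'\<in>nsets R (r - 1). f e')"
    by (simp add: assms(7) Psi_def)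
  also have "\<dots> = of_nat (card (nsets R (r - 1))) * (c + 1)"
    using f_R by simp
  also have "card (nsets R (r - 1)) = r"
  proof -
    have "card R = r"
      using R by (simp add: nsets_def)
    then show ?thesis
      using \<open>r \<ge> 3\<close> binomial_symmetric[of 1 r] by (simp add: card_nsets)
  qed
  \<comment> \<open>Writing \<open>r = 2 * b + 1\<close>, the even part vanishes because
    \<open>2 = 0\<close> in \<open>bit\<close>.\<close>
  also have "of_nat r * (c + 1) = c + 1"
    using \<open>odd r\<close> by (auto elim!: oddE)
  finally show False
    using assms(9)[OF R] by (cases c) simp_all
qed

end
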